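(* Let $E$ be a nonzero real Banach space and let $S : E \rightrightarrows E^*$ be maximally monotone and surjective (that is, $\bigcup_{x \in E} Sx = E^*$). Then $S$ is quasidense.
   Context: For a multifunction $S : E \rightrightarrows E^*$, $G(S) := \{(x,x^* ) : x^* \in Sx\}$ is its graph; $S$ is maximally monotone if $G(S)$ is a maximally monotone subset of $E \times E^*$. $S$ is quasidense if, for all $(x,x^* ) \in E \times E^*$, $\inf_{(s,s^* ) \in G(S)}\big[\frac12\|s-x\|^2 + \frac12\|s^*-x^*\|^2 + \langle s-x, s^*-x^*\rangle\big] \le 0$. *)

theory Defs
  imports "HOL-Analysis.Analysis"
begin

type_synonym 'a dual = "'a \<Rightarrow>\<^sub>L real"

definition mgraph :: "('a::real_normed_vector \<Rightarrow> 'a dual set) \<Rightarrow> ('a \<times> 'a dual) set" where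
  "mgraph S = {(x, xs). xs \<in> S x}"

definition monotone_subset :: "('a::real_normed_vector \<times> 'a dual) set \<Rightarrow> bool" where
  "monotone_subset A \<longleftrightarrow>
     (\<forall>(x, xs) \<in> A. \<forall>(y, ys) \<in> A. 0 \<le> blinfun_apply (xs - ys) (x - y))"

definition maximally_monotone_subset :: "('a::real_normed_vector \<times> 'a dual) set \<Rightarrow> bool" where
  "maximally_monotone_subset A \<longleftrightarrow>
     monotone_subset A \<and> (\<forall>B. monotone_subset B \<longrightarrow> A \<subseteq> B \<longrightarrow> B = A)"

definition maximally_monotone :: "('a::real_normed_vector \<Rightarrow> 'a dual set) \<Rightarrow> bool" where
  "maximally_monotone S \<longleftrightarrow> maximally_monotone_subset (mgraph S)"

(* The infimum is taken in the extended reals, so that the infimum over an empty graph is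
   +infinity, as is usual in convex analysis. *)
definition quasidense :: "('a::real_normed_vector \<Rightarrow> 'a dual set) \<Rightarrow> bool" where
  "quasidense S \<longleftrightarrow>
     (\<forall>x xs. (INF (s, ss) \<in> mgraph S.
        ereal (1/2 * (norm (s - x))\<^sup>2 + 1/2 * (norm (ss - xs))\<^sup>2
               + blinfun_apply (ss - xs) (s - x))) \<le> 0)"

end

theory Submission
  imports Defs
begin

text \<open>
  Write \<open>q\<close> for the duality pairing \<open>q (x, x\<^sup>*) = x\<^sup>* x\<close> on \<open>E \<times> E\<^sup>*\<close> and \<open>G\<close> for the graph of
  \<open>S\<close>. With the Euclidean product norm, quasidensity says that \<open>\<parallel>u - p\<parallel>\<^sup>2 / 2 + q (u - p)\<close>, a
  nonnegative quantity, can be made arbitrarily small over \<open>u \<in> G\<close>, for every point \<open>p\<close>.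

  The graph itself is not convex, so the problem is first relaxed. The \<open>t\<close>-enlargement of \<open>G\<close>
  consists of the \<open>w\<close> with \<open>q (w - g) \<ge> -t\<close> for all \<open>g \<in> G\<close>. The pairs \<open>(w, c)\<close> for which \<open>w\<close> lies
  in the \<open>(c - q w)\<close>-enlargement form the epigraph of the Fitzpatrick function of \<open>G\<close>, which is
  convex. The relaxed problem asks for \<open>w\<close> in the \<open>t\<close>-enlargement with
  \<open>t + \<parallel>w - p\<parallel>\<^sup>2 / 2 + q (w - p) < d\<close>.

  Surjectivity solves it (\<open>surjective_approximate_solution\<close>). Take \<open>p = 0\<close>. If the quantity were
  always at least \<open>d > 0\<close>, a convex form of the Hahn--Banach theorem would give \<open>y \<in> E\<^sup>*\<close> such that
  replacing \<open>\<parallel>x\<parallel>\<^sup>2 / 2\<close> by \<open>\<parallel>x - z\<parallel>\<^sup>2 / 2\<close>, where \<open>w = (x, x\<^sup>*)\<close>, keeps it at least \<open>d + y z\<close> for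
  all \<open>z\<close>. A point \<open>(s, y) \<in> G\<close> exists by surjectivity and lies in the \<open>0\<close>-enlargement; at
  \<open>z = s - v\<close> it gives \<open>y v + \<parallel>v\<parallel>\<^sup>2 / 2 + \<parallel>y\<parallel>\<^sup>2 / 2 \<ge> d\<close> for all \<open>v\<close>, which is absurd because the
  infimum of the left side is \<open>0\<close>.

  Approximate solutions are then corrected to points of \<open>G\<close>. Maximality forces \<open>t \<ge> 0\<close> whenever the
  \<open>t\<close>-enlargement is inhabited, and applying this to the midpoint of two points \<open>v\<close>, \<open>w\<close> in the
  \<open>s\<close>- and \<open>t\<close>-enlargements gives \<open>q (v - w) \<ge> -2 (s + t)\<close>. So a solution of the relaxed
  problem that is based at \<open>p = w\<close>, with \<open>w\<close> itself in a small enlargement, is close to \<open>w\<close> in norm.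
  Iterating produces a Cauchy sequence, whose limit lies in the \<open>0\<close>-enlargement, that is, in \<open>G\<close>
  (\<open>surjective_graph_near_enlargement\<close>).
\<close>

section \<open>A Hahn--Banach theorem for convex sets\<close>

definition sublinear :: "('v::real_vector \<Rightarrow> real) \<Rightarrow> bool" where
  "sublinear p \<longleftrightarrow>
     (\<forall>x y. p (x + y) \<le> p x + p y) \<and> (\<forall>c x. c > 0 \<longrightarrow> p (c *\<^sub>R x) = c * p x)"

lemma sublinearI:
  assumes "\<And>x y. p (x + y) \<le> p x + p y" and le: "\<And>c x. c > 0 \<Longrightarrow> p (c *\<^sub>R x) \<le> c * p x"
  shows "sublinear p"
proof -
  have "p (c *\<^sub>R x) = c * p x" if c: "c > 0" for c x
  proof -
    have "p ((1 / c) *\<^sub>R (c *\<^sub>R x)) \<le> (1 / c) * p (c *\<^sub>R x)"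
      using c by (intro le) simp
    then have "c * p x \<le> p (c *\<^sub>R x)"
      using c by (simp add: field_simps)
    then show ?thesis
      using le[OF c, of x] by simp
  qed
  then show ?thesis
    using assms(1) by (simp add: sublinear_def)
qed

lemma sublinear_add: "sublinear p \<Longrightarrow> p (x + y) \<le> p x + p y"
  and sublinear_scale: "sublinear p \<Longrightarrow> c > 0 \<Longrightarrow> p (c *\<^sub>R x) = c * p x"
  by (auto simp: sublinear_def)

lemma sublinear_zero: "sublinear p \<Longrightarrow> p 0 = 0"
  using sublinear_scale[of p 2 0] by simp

lemma sublinear_minus: "sublinear p \<Longrightarrow> - p (- x) \<le> p x"
  using sublinear_add[of p x "- x"] sublinear_zero[of p] by simp

text \<open>
  For each \<open>a\<close> the function \<open>x \<mapsto> inf {m (x + t a) - t m a | t \<ge> 0}\<close> is again sublinear and at most \<open>m\<close>,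
  so it equals \<open>m\<close>. Taking \<open>t = 1\<close> shows that \<open>m\<close> is superadditive as well as subadditive.
\<close>

lemma minimal_sublinear_linear:
  fixes m :: "'v::real_vector \<Rightarrow> real"
  assumes m: "sublinear m"
    and min: "\<And>p. sublinear p \<Longrightarrow> (\<And>x. p x \<le> m x) \<Longrightarrow> p = m"
  shows "linear m"
proof -
  have super: "m x + m a \<le> m (x + a)" for x a
  proof -
    let ?V = "\<lambda>x. {m (x + t *\<^sub>R a) - t * m a | t. t \<ge> 0}"
    define p where "p x = Inf (?V x)" for x
    have scale0: "m (t *\<^sub>R a) = t * m a" if "t \<ge> 0" for t
      using that sublinear_scale[OF m, of t a] sublinear_zero[OF m] by (cases "t = 0") auto
    have ne: "?V x \<noteq> {}" for x
      by (auto intro: exI[of _ 0])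
    have bdd: "bdd_below (?V x)" for x
    proof (rule bdd_belowI)
      fix r assume "r \<in> ?V x"
      then obtain t where t: "t \<ge> 0" "r = m (x + t *\<^sub>R a) - t * m a"
        by blast
      have "m (t *\<^sub>R a) \<le> m (x + t *\<^sub>R a) + m (- x)"
        using sublinear_add[OF m, of "x + t *\<^sub>R a" "- x"] by simp
      then show "- m (- x) \<le> r"
        using t scale0 by simp
    qed
    have low: "p x \<le> m (x + t *\<^sub>R a) - t * m a" if "t \<ge> 0" for x t
      unfolding p_def using that by (intro cInf_lower[OF _ bdd]) blast
    have "sublinear p"
    proof (rule sublinearI)
      fix x y
      have "p (x + y) - v \<le> u" if u: "u \<in> ?V x" and v: "v \<in> ?V y" for u v
      proof -
        obtain s t where s: "s \<ge> 0" "u = m (x + s *\<^sub>R a) - s * m a"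
          and t: "t \<ge> 0" "v = m (y + t *\<^sub>R a) - t * m a"
          using u v by blast
        have "p (x + y) \<le> m ((x + y) + (s + t) *\<^sub>R a) - (s + t) * m a"
          using s t by (intro low) simp
        also have "(x + y) + (s + t) *\<^sub>R a = (x + s *\<^sub>R a) + (y + t *\<^sub>R a)"
          by (simp add: algebra_simps)
        finally show ?thesis
          using sublinear_add[OF m, of "x + s *\<^sub>R a" "y + t *\<^sub>R a"] s t
          by (simp add: algebra_simps)
      qed
      then have "p (x + y) - v \<le> p x" if "v \<in> ?V y" for v
        unfolding p_def[of x] using that by (intro cInf_greatest[OF ne]) blast
      then have "p (x + y) - p x \<le> v" if "v \<in> ?V y" for v
        using that by fastforce
      then have "p (x + y) - p x \<le> p y"
        unfolding p_def[of y] by (intro cInf_greatest[OF ne])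
      then show "p (x + y) \<le> p x + p y"
        by simp
    next
      fix c :: real and x
      assume c: "c > 0"
      have "p (c *\<^sub>R x) / c \<le> v" if v: "v \<in> ?V x" for v
      proof -
        obtain t where t: "t \<ge> 0" "v = m (x + t *\<^sub>R a) - t * m a"
          using v by blast
        have "p (c *\<^sub>R x) \<le> m (c *\<^sub>R x + (c * t) *\<^sub>R a) - (c * t) * m a"
          using c t by (intro low) simp
        also have "c *\<^sub>R x + (c * t) *\<^sub>R a = c *\<^sub>R (x + t *\<^sub>R a)"
          by (simp add: algebra_simps)
        finally have "p (c *\<^sub>R x) \<le> v * c"
          unfolding t(2) sublinear_scale[OF m c] by (simp add: algebra_simps)
        then show ?thesis
          using c by (simp add: pos_divide_le_eq)
      qed
      then have "p (c *\<^sub>R x) / c \<le> p x"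
        unfolding p_def[of x] by (intro cInf_greatest[OF ne])
      then show "p (c *\<^sub>R x) \<le> c * p x"
        using c by (simp add: field_simps)
    qed
    then have "p = m"
      using low[of 0] by (intro min) auto
    then show ?thesis
      using low[of 1 x] by simp
  qed
  then have add: "m (x + y) = m x + m y" for x y
    using sublinear_add[OF m] by (intro antisym) auto
  have neg: "m (- x) = - m x" for x
    using add[of x "- x"] sublinear_zero[OF m] by simp
  have "m (c *\<^sub>R x) = c * m x" for c x
  proof (cases "c > 0")
    case True
    then show ?thesis
      by (rule sublinear_scale[OF m])
  next
    case False
    then show ?thesis
      using sublinear_scale[OF m, of "- c" x] neg[of "c *\<^sub>R x"] sublinear_zero[OF m]
      by (cases "c = 0") auto
  qed
  then show ?thesis
    using add by (intro linearI) auto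
qed

text \<open>
  By Zorn's lemma there is a minimal sublinear function below \<open>p\<close>: a chain has a pointwise infimum
  because \<open>- p (- x)\<close> bounds all its members from below at \<open>x\<close>.
\<close>

lemma linear_below_sublinear:
  fixes p :: "'v::real_vector \<Rightarrow> real"
  assumes p: "sublinear p"
  obtains l where "linear l" "\<And>x. l x \<le> p x"
proof -
  let ?A = "{m. sublinear m \<and> (\<forall>x. m x \<le> p x)}"
  let ?P = "\<lambda>f g :: 'v \<Rightarrow> real. g \<le> f"
  have "\<exists>m\<in>?A. \<forall>a\<in>?A. ?P m a \<longrightarrow> a = m"
  proof (rule predicate_Zorn)
    show "partial_order_on ?A (relation_of ?P ?A)"
      by (rule partial_order_on_relation_ofI) auto
  next
    fix C assume C: "C \<in> Chains (relation_of ?P ?A)"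
    then have CA: "C \<subseteq> ?A"
      by (auto simp: Chains_def relation_of_def)
    have tot: "f \<le> g \<or> g \<le> f" if "f \<in> C" "g \<in> C" for f g
      using C that by (auto simp: Chains_def relation_of_def)
    show "\<exists>u\<in>?A. \<forall>a\<in>C. ?P a u"
    proof (cases "C = {}")
      case True
      then show ?thesis
        using p by auto
    next
      case False
      let ?V = "\<lambda>x. (\<lambda>f. f x) ` C"
      define u where "u x = Inf (?V x)" for x
      have ne: "?V x \<noteq> {}" for x
        using False by simp
      have "- p (- x) \<le> f x" if "f \<in> C" for f x
        using CA that sublinear_minus[of f x] by (force intro: order_trans[rotated])
      then have bdd: "bdd_below (?V x)" for x
        by (intro bdd_belowI) auto
      have low: "u x \<le> f x" if "f \<in> C" for f x
        unfolding u_def using that by (intro cInf_lower[OF _ bdd]) simp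
      have "sublinear u"
      proof (rule sublinearI)
        fix x y
        have "u (x + y) - g y \<le> f x" if fg: "f \<in> C" "g \<in> C" for f g
        proof -
          obtain h where h: "h \<in> C" "h \<le> f" "h \<le> g"
            using tot[OF fg] fg by blast
          have "u (x + y) \<le> h x + h y"
            using low[OF h(1)] sublinear_add[of h x y] CA h(1) by (force intro: order_trans)
          then show ?thesis
            using le_funD[OF h(2), of x] le_funD[OF h(3), of y] by simp
        qed
        then have "u (x + y) - g y \<le> u x" if "g \<in> C" for g
          unfolding u_def[of x] using that by (intro cInf_greatest[OF ne]) auto
        then have "u (x + y) - u x \<le> u y"
          unfolding u_def[of y] by (intro cInf_greatest[OF ne]) fastforce
        then show "u (x + y) \<le> u x + u y"
          by simp
      next
        fix c :: real and x
        assume c: "c > 0"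
        have "u (c *\<^sub>R x) / c \<le> f x" if "f \<in> C" for f
        proof -
          have "sublinear f"
            using CA that by auto
          then have "f (c *\<^sub>R x) = c * f x"
            by (rule sublinear_scale[OF _ c])
          then show ?thesis
            using low[OF that, of "c *\<^sub>R x"] c by (simp add: field_simps)
        qed
        then have "u (c *\<^sub>R x) / c \<le> u x"
          unfolding u_def[of x] by (intro cInf_greatest[OF ne]) auto
        then show "u (c *\<^sub>R x) \<le> c * u x"
          using c by (simp add: field_simps)
      qed
      moreover have "u x \<le> p x" for x
      proof -
        obtain f where "f \<in> C"
          using False by auto
        then have "u x \<le> f x" "f x \<le> p x"
          using low[of f x] CA by auto
        then show ?thesis
          by simp
      qed
      ultimately have "u \<in> ?A"
        by simp
      moreover have "\<forall>a\<in>C. u \<le> a"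
        using low by (simp add: le_fun_def)
      ultimately show ?thesis
        by blast
    qed
  qed
  then obtain m where m: "sublinear m" "\<And>x. m x \<le> p x"
    and min: "\<And>a. sublinear a \<Longrightarrow> (\<And>x. a x \<le> p x) \<Longrightarrow> a \<le> m \<Longrightarrow> a = m"
    by blast
  have "linear m"
  proof (rule minimal_sublinear_linear[OF m(1)])
    fix a assume "sublinear a" "\<And>x. a x \<le> m x"
    then show "a = m"
      by (intro min) (auto simp: le_fun_def intro: order_trans[OF _ m(2)])
  qed
  then show thesis
    using m(2) by (rule that)
qed

text \<open>
  If \<open>K\<close> is the epigraph of a convex function \<open>k\<close> with \<open>k 0 \<ge> 0\<close>, then \<open>l\<close> is a linear minorant of
  \<open>k\<close>. It is found below \<open>p z = inf {k (t z) / t | t > 0}\<close>, which is finite because \<open>k 0 \<ge> 0\<close>, and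
  sublinear. Working with a set instead of a function avoids taking infima when \<open>K\<close> is itself given by
  an existential condition.
\<close>

lemma linear_below_convex_set:
  fixes K :: "('v::real_vector \<times> real) set"
  assumes K: "convex K"
    and onto: "\<And>z. \<exists>c. (z, c) \<in> K"
    and zero: "\<And>c. (0, c) \<in> K \<Longrightarrow> 0 \<le> c"
  obtains l where "linear l" "\<And>z c. (z, c) \<in> K \<Longrightarrow> l z \<le> c"
proof -
  have comb: "(a *\<^sub>R x + b *\<^sub>R y, a * c + b * d) \<in> K"
    if "(x, c) \<in> K" "(y, d) \<in> K" "a \<ge> 0" "b \<ge> 0" "a + b = 1" for a b c d x y
    using convexD[OF K that] by simp
  let ?V = "\<lambda>z. {c / t | c t. t > 0 \<and> (t *\<^sub>R z, c) \<in> K}"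
  define p where "p z = Inf (?V z)" for z
  have ne: "?V z \<noteq> {}" for z
  proof -
    obtain c where "(1 *\<^sub>R z, c) \<in> K"
      using onto by auto
    then have "c / 1 \<in> ?V z"
      using zero_less_one by blast
    then show ?thesis
      by blast
  qed
  have bdd: "bdd_below (?V z)" for z
  proof -
    obtain d where d: "(- z, d) \<in> K"
      using onto by blast
    \<comment> \<open>The origin is the convex combination of \<open>t z\<close> and \<open>- z\<close> with weights \<open>1\<close> and \<open>t\<close>, normalized.\<close>
    have "- d \<le> c / t" if t: "t > 0" and c: "(t *\<^sub>R z, c) \<in> K" for c t
    proof -
      have "((1 / (1 + t)) *\<^sub>R t *\<^sub>R z + (t / (1 + t)) *\<^sub>R - z, 1 / (1 + t) * c + t / (1 + t) * d) \<in> K"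
        using t by (intro comb c d) (auto simp: field_simps)
      then have "0 \<le> 1 / (1 + t) * c + t / (1 + t) * d"
        by (intro zero) simp
      also have "\<dots> = (c + t * d) / (1 + t)"
        by (simp add: add_divide_distrib)
      finally have "0 \<le> c + t * d"
        using t by (simp add: zero_le_divide_iff)
      then show ?thesis
        using t by (simp add: field_simps)
    qed
    then show ?thesis
      by (intro bdd_belowI[of _ "- d"]) blast
  qed
  have low: "p z \<le> c / t" if "t > 0" "(t *\<^sub>R z, c) \<in> K" for z c t
    unfolding p_def using that by (intro cInf_lower[OF _ bdd]) blast
  have "sublinear p"
  proof (rule sublinearI)
    fix x y
    have "p (x + y) - v \<le> u" if u: "u \<in> ?V x" and v: "v \<in> ?V y" for u v
    proof -
      obtain c s where s: "s > 0" "(s *\<^sub>R x, c) \<in> K" "u = c / s"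
        using u by blast
      obtain d t where t: "t > 0" "(t *\<^sub>R y, d) \<in> K" "v = d / t"
        using v by blast
      \<comment> \<open>These weights turn \<open>s x\<close> and \<open>t y\<close> into a common multiple of \<open>x + y\<close>.\<close>
      have "s + t > 0"
        using s t by simp
      then have "((t / (s + t)) *\<^sub>R s *\<^sub>R x + (s / (s + t)) *\<^sub>R t *\<^sub>R y,
          t / (s + t) * c + s / (s + t) * d) \<in> K"
        using s t by (intro comb) (auto simp flip: add_divide_distrib simp: add.commute)
      moreover have "(t / (s + t)) *\<^sub>R s *\<^sub>R x + (s / (s + t)) *\<^sub>R t *\<^sub>R y
          = (s * t / (s + t)) *\<^sub>R (x + y)"
        by (simp add: algebra_simps)
      ultimately have "p (x + y) \<le> (t / (s + t) * c + s / (s + t) * d) / (s * t / (s + t))"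
        using s t by (intro low) auto
      also have "\<dots> = (t * c + s * d) / (s * t)"
        using s t by (simp add: add_divide_distrib[symmetric])
      also have "\<dots> = u + v"
        using s t by (simp add: field_simps)
      finally show ?thesis
        by simp
    qed
    then have "p (x + y) - v \<le> p x" if "v \<in> ?V y" for v
      unfolding p_def[of x] using that by (intro cInf_greatest[OF ne]) blast
    then have "p (x + y) - p x \<le> v" if "v \<in> ?V y" for v
      using that by fastforce
    then have "p (x + y) - p x \<le> p y"
      unfolding p_def[of y] by (intro cInf_greatest[OF ne])
    then show "p (x + y) \<le> p x + p y"
      by simp
  next
    fix a :: real and x
    assume a: "a > 0"
    have "p (a *\<^sub>R x) / a \<le> v" if v: "v \<in> ?V x" for v
    proof -
      obtain c t where t: "t > 0" "(t *\<^sub>R x, c) \<in> K" "v = c / t"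
        using v by blast
      have "p (a *\<^sub>R x) \<le> c / (t / a)"
        using a t by (intro low) auto
      then have "p (a *\<^sub>R x) \<le> v * a"
        using a t by simp
      then show ?thesis
        using a by (simp add: pos_divide_le_eq)
    qed
    then have "p (a *\<^sub>R x) / a \<le> p x"
      unfolding p_def[of x] by (intro cInf_greatest[OF ne])
    then show "p (a *\<^sub>R x) \<le> a * p x"
      using a by (simp add: field_simps)
  qed
  then obtain l where l: "linear l" "\<And>x. l x \<le> p x"
    using linear_below_sublinear by blast
  have "l z \<le> c" if "(z, c) \<in> K" for z c
    using l(2)[of z] low[of 1 z c] that by simp
  with l(1) show thesis
    by (rule that)
qed

section \<open>The duality pairing and enlargements of a graph\<close>

definition pairing :: "'a::real_normed_vector \<times> 'a dual \<Rightarrow> real" where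
  "pairing w = blinfun_apply (snd w) (fst w)"

lemma pairing_minus: "pairing (- w) = pairing w"
  by (simp add: pairing_def blinfun.bilinear_simps)

lemma pairing_convex_combination:
  assumes "a + b = 1"
  shows "pairing (a *\<^sub>R v + b *\<^sub>R w) = a * pairing v + b * pairing w - a * b * pairing (v - w)"
proof -
  have b: "b = 1 - a"
    using assms by simp
  show ?thesis
    unfolding b by (simp add: pairing_def blinfun.bilinear_simps algebra_simps)
qed

lemma norm_Pair_power2: "(norm w)\<^sup>2 = (norm (fst w))\<^sup>2 + (norm (snd w))\<^sup>2"
  by (simp add: norm_prod_def)

lemma abs_pairing_le: "\<bar>pairing w\<bar> \<le> (norm w)\<^sup>2 / 2"
proof -
  have "\<bar>pairing w\<bar> \<le> norm (snd w) * norm (fst w)"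
    using norm_blinfun[of "snd w" "fst w"] by (simp add: pairing_def)
  also have "2 * \<dots> \<le> (norm w)\<^sup>2"
    using sum_squares_bound[of "norm (snd w)" "norm (fst w)"] norm_Pair_power2[of w] by simp
  finally show ?thesis by simp
qed

lemma pairing_add_le:
  fixes v w :: "'a::real_normed_vector \<times> 'a dual"
  shows "pairing (v + w) \<le> pairing v + (norm w)\<^sup>2 / 2 + 2 * norm v * norm w"
proof -
  have cross: "\<bar>blinfun_apply (snd a) (fst b)\<bar> \<le> norm a * norm b" for a b :: "'a \<times> 'a dual"
  proof -
    have "\<bar>blinfun_apply (snd a) (fst b)\<bar> \<le> norm (snd a) * norm (fst b)"
      using norm_blinfun[of "snd a" "fst b"] by simp
    also have "\<dots> \<le> norm a * norm b"
      using norm_fst_le[of "fst b" "snd b"] norm_snd_le[of "snd a" "fst a"]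
      by (intro mult_mono) auto
    finally show ?thesis .
  qed
  have "pairing (v + w) = pairing v + pairing w
      + blinfun_apply (snd v) (fst w) + blinfun_apply (snd w) (fst v)"
    by (simp add: pairing_def blinfun.bilinear_simps)
  then show ?thesis
    using cross[of v w] cross[of w v] abs_pairing_le[of w] mult.commute[of "norm v" "norm w"]
    by linarith
qed

lemma tendsto_pairing [tendsto_intros]:
  assumes "(f \<longlongrightarrow> w) F"
  shows "((\<lambda>x. pairing (f x)) \<longlongrightarrow> pairing w) F"
  unfolding pairing_def by (intro tendsto_intros assms)

lemma monotone_subset_iff:
  "monotone_subset G \<longleftrightarrow> (\<forall>v\<in>G. \<forall>w\<in>G. 0 \<le> pairing (v - w))"
  unfolding monotone_subset_def pairing_def case_prod_beta by simp

text \<open>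
  The \<open>t\<close>-enlargement of a monotone graph, in the sense of Burachik, Iusem and Svaiter. If \<open>f\<close> denotes
  the Fitzpatrick function of \<open>G\<close>, then \<open>w\<close> belongs to it exactly when \<open>f w - pairing w \<le> t\<close>.
\<close>

definition enlargement ::
  "('a::real_normed_vector \<times> 'a dual) set \<Rightarrow> real \<Rightarrow> ('a \<times> 'a dual) set" where
  "enlargement G t = {w. \<forall>g\<in>G. - t \<le> pairing (w - g)}"

lemma enlargement_mono: "s \<le> t \<Longrightarrow> enlargement G s \<subseteq> enlargement G t"
  by (force simp: enlargement_def)

text \<open>
  This is the convexity of the Fitzpatrick function, whose epigraph is parametrized by
  \<open>t + pairing w\<close>: the correction \<open>a * b * pairing (v - w)\<close> is the deviation of the pairing from being
  affine.
\<close>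

lemma enlargement_convex_combination:
  assumes "v \<in> enlargement G s" "w \<in> enlargement G t" "a \<ge> 0" "b \<ge> 0" "a + b = 1"
  shows "a *\<^sub>R v + b *\<^sub>R w \<in> enlargement G (a * s + b * t + a * b * pairing (v - w))"
  unfolding enlargement_def
proof (intro CollectI ballI)
  fix g assume g: "g \<in> G"
  have "a *\<^sub>R v + b *\<^sub>R w - g = a *\<^sub>R (v - g) + b *\<^sub>R (w - g)"
    using assms(5) by (simp add: algebra_simps flip: scaleR_add_left)
  then have "pairing (a *\<^sub>R v + b *\<^sub>R w - g)
      = a * pairing (v - g) + b * pairing (w - g) - a * b * pairing (v - w)"
    using pairing_convex_combination[OF assms(5), of "v - g" "w - g"] by simp
  moreover have "a * (- s) \<le> a * pairing (v - g)" "b * (- t) \<le> b * pairing (w - g)"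
    using assms(1-4) g by (auto simp only: enlargement_def mem_Collect_eq intro!: mult_left_mono)
  ultimately show "- (a * s + b * t + a * b * pairing (v - w)) \<le> pairing (a *\<^sub>R v + b *\<^sub>R w - g)"
    by simp
qed

text \<open>
  The points of the \<open>0\<close>-enlargement are those that can be added to \<open>G\<close> without losing monotonicity.
\<close>

lemma enlargement_zero_maximal:
  assumes G: "maximally_monotone_subset G" and w: "w \<in> enlargement G 0"
  shows "w \<in> G"
proof -
  have "pairing (g - w) = pairing (w - g)" for g
    using pairing_minus[of "w - g"] by simp
  then have "monotone_subset (insert w G)"
    using G w unfolding maximally_monotone_subset_def monotone_subset_iff enlargement_def
    by (auto simp: pairing_def)
  then have "insert w G = G"
    using G by (auto simp: maximally_monotone_subset_def)
  then show ?thesis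
    by blast
qed

text \<open>
  Equivalently, the Fitzpatrick function of a maximally monotone set dominates the pairing.
\<close>

lemma enlargement_maximal_nonneg:
  assumes G: "maximally_monotone_subset G" and w: "w \<in> enlargement G t"
  shows "0 \<le> t"
proof (rule ccontr)
  assume "\<not> 0 \<le> t"
  then have "w \<in> enlargement G 0"
    using w enlargement_mono[of t 0 G] by auto
  then have "w \<in> G"
    by (rule enlargement_zero_maximal[OF G])
  then have "- t \<le> pairing (w - w)"
    using w unfolding enlargement_def by blast
  then show False
    using \<open>\<not> 0 \<le> t\<close> by (simp add: pairing_def)
qed

text \<open>
  The midpoint of \<open>v\<close> and \<open>w\<close> lies in the enlargement with parameter
  \<open>(s + t) / 2 + pairing (v - w) / 4\<close>, which must be nonnegative.
\<close>

lemma enlargement_pairing_ge: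
  assumes G: "maximally_monotone_subset G"
    and v: "v \<in> enlargement G s" and w: "w \<in> enlargement G t"
  shows "- 2 * (s + t) \<le> pairing (v - w)"
proof -
  have "(1/2) *\<^sub>R v + (1/2) *\<^sub>R w
      \<in> enlargement G (1/2 * s + 1/2 * t + 1/2 * (1/2) * pairing (v - w))"
    by (rule enlargement_convex_combination[OF v w]) auto
  from enlargement_maximal_nonneg[OF G this] show ?thesis
    by simp
qed

section \<open>Surjectivity gives approximate solutions\<close>

text \<open>
  The function \<open>v \<mapsto> \<parallel>v\<parallel>\<^sup>2 / 2\<close> has conjugate \<open>y \<mapsto> \<parallel>y\<parallel>\<^sup>2 / 2\<close>: choose \<open>v\<close> of norm close to
  \<open>\<parallel>y\<parallel>\<close> in a direction where \<open>- y\<close> almost attains its norm.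
\<close>

lemma approximately_dual_vector:
  fixes y :: "'a::real_normed_vector dual"
  assumes d: "d > 0"
  obtains v where "blinfun_apply y v + (norm v)\<^sup>2 / 2 + (norm y)\<^sup>2 / 2 < d"
proof (rule ccontr)
  assume "\<not> thesis"
  then have gap: "d \<le> blinfun_apply y v + (norm v)\<^sup>2 / 2 + (norm y)\<^sup>2 / 2" for v
    using that by (meson not_less)
  have "2 * d \<le> (norm y)\<^sup>2"
    using gap[of 0] by (simp add: blinfun.bilinear_simps)
  then have Y: "norm y > 0" "d \<le> (norm y)\<^sup>2"
    using d by (auto simp: zero_less_norm_iff intro!: gr_zeroI)
  \<comment> \<open>Rescaling \<open>- v\<close> to norm \<open>\<parallel>y\<parallel>\<close> makes the gap contradict the definition of the operator norm.\<close>
  have bound: "blinfun_apply y v \<le> ((norm y)\<^sup>2 - d) / norm y * norm v" for v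
  proof (cases "v = 0")
    case True
    then show ?thesis by (simp add: blinfun.bilinear_simps)
  next
    case False
    have "d \<le> (norm y)\<^sup>2 - norm y / norm v * blinfun_apply y v"
      using gap[of "- (norm y / norm v) *\<^sub>R v"] False
      by (simp add: blinfun.bilinear_simps)
    then show ?thesis
      using False Y by (simp add: field_simps)
  qed
  have "norm y \<le> ((norm y)\<^sup>2 - d) / norm y"
  proof (rule norm_blinfun_bound)
    show "0 \<le> ((norm y)\<^sup>2 - d) / norm y"
      using Y by simp
    show "norm (blinfun_apply y v) \<le> ((norm y)\<^sup>2 - d) / norm y * norm v" for v
      using bound[of v] bound[of "- v"] by (simp add: blinfun.bilinear_simps abs_le_iff)
  qed
  then show False
    using Y d by (simp add: field_simps power2_eq_square)
qed

lemma convex_norm_power2: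
  assumes "a \<ge> 0" "b \<ge> 0" "a + b = 1"
  shows "(norm (a *\<^sub>R x + b *\<^sub>R y))\<^sup>2 \<le> a * (norm x)\<^sup>2 + b * (norm y)\<^sup>2"
proof -
  have "(norm (a *\<^sub>R x + b *\<^sub>R y))\<^sup>2 \<le> (a * norm x + b * norm y)\<^sup>2"
    using assms norm_triangle_ineq[of "a *\<^sub>R x" "b *\<^sub>R y"] by (intro power_mono) auto
  also have "\<dots> = a * (norm x)\<^sup>2 + b * (norm y)\<^sup>2 - a * b * (norm x - norm y)\<^sup>2"
  proof -
    have b: "b = 1 - a" using assms by simp
    show ?thesis unfolding b by (simp add: power2_eq_square algebra_simps)
  qed
  also have "\<dots> \<le> a * (norm x)\<^sup>2 + b * (norm y)\<^sup>2"
    using assms by simp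
  finally show ?thesis .
qed

text \<open>
  Only the first component of \<open>w - p\<close> is perturbed in the convex set \<open>K\<close> below, so the Hahn--Banach
  theorem yields a functional \<open>y\<close> on \<open>E\<close>, an element of \<open>E\<^sup>*\<close> to which surjectivity applies. Perturbing both
  components, as in Fenchel duality on \<open>E \<times> E\<^sup>*\<close>, would bring in the bidual.
\<close>

lemma surjective_approximate_solution:
  fixes G :: "('a::real_normed_vector \<times> 'a dual) set"
  assumes G: "monotone_subset G" and surj: "\<And>y. \<exists>x. (x, y) \<in> G" and d: "d > 0"
  obtains t w where "w \<in> enlargement G t" "t + (norm (w - p))\<^sup>2 / 2 + pairing (w - p) < d"
proof (rule ccontr)
  assume "\<not> thesis"
  then have gap: "d \<le> t + (norm (w - p))\<^sup>2 / 2 + pairing (w - p)"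
    if "w \<in> enlargement G t" for t w
    using \<open>\<And>w t. w \<in> enlargement G t \<Longrightarrow> t + (norm (w - p))\<^sup>2 / 2 + pairing (w - p) < d \<Longrightarrow> thesis\<close> that
    by (meson not_le)
  define h where "h t w z = t + pairing (w - p) + (norm (fst (w - p) - z))\<^sup>2 / 2
      + (norm (snd (w - p)))\<^sup>2 / 2 - d" for t w z
  define K where "K = {(z, c). \<exists>t w. w \<in> enlargement G t \<and> h t w z \<le> c}"
  have G_enl: "g \<in> enlargement G 0" if "g \<in> G" for g
    using G that by (auto simp: enlargement_def monotone_subset_iff)
  have G_K: "(z, h 0 g z) \<in> K" if "g \<in> G" for g z
    unfolding K_def using G_enl[OF that] by blast
  \<comment> \<open>The correction from the enlargement parameter cancels against that from the pairing, so that
    \<open>h\<close> behaves like a convex function of its arguments together.\<close>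
  have K_convex: "convex K"
  proof (rule convexI)
    fix k k' :: "'a \<times> real" and a b :: real
    assume k: "k \<in> K" "k' \<in> K" and ab: "0 \<le> a" "0 \<le> b" "a + b = 1"
    obtain z c t w where zc: "k = (z, c)" "w \<in> enlargement G t" "h t w z \<le> c"
      using k(1) by (auto simp: K_def)
    obtain z' c' t' w' where zc': "k' = (z', c')" "w' \<in> enlargement G t'" "h t' w' z' \<le> c'"
      using k(2) by (auto simp: K_def)
    let ?w = "a *\<^sub>R w + b *\<^sub>R w'" and ?z = "a *\<^sub>R z + b *\<^sub>R z'"
      and ?t = "a * t + b * t' + a * b * pairing (w - w')"
    have wp: "?w - p = a *\<^sub>R (w - p) + b *\<^sub>R (w' - p)"
      using ab by (simp add: algebra_simps flip: scaleR_add_left)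
    have "pairing (?w - p) = a * pairing (w - p) + b * pairing (w' - p) - a * b * pairing (w - w')"
      unfolding wp using pairing_convex_combination[OF ab(3), of "w - p" "w' - p"] by simp
    moreover have "(norm (fst (?w - p) - ?z))\<^sup>2
        \<le> a * (norm (fst (w - p) - z))\<^sup>2 + b * (norm (fst (w' - p) - z'))\<^sup>2"
    proof -
      have "fst (?w - p) - ?z = a *\<^sub>R (fst (w - p) - z) + b *\<^sub>R (fst (w' - p) - z')"
        unfolding wp by (simp add: algebra_simps)
      then show ?thesis
        using convex_norm_power2[OF ab] by metis
    qed
    moreover have "(norm (snd (?w - p)))\<^sup>2
        \<le> a * (norm (snd (w - p)))\<^sup>2 + b * (norm (snd (w' - p)))\<^sup>2"
      unfolding wp using convex_norm_power2[OF ab, of "snd (w - p)" "snd (w' - p)"] by simp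
    moreover have "d = a * d + b * d"
      using ab by (simp flip: distrib_right)
    ultimately have "h ?t ?w ?z \<le> a * h t w z + b * h t' w' z'"
      unfolding h_def by (simp add: algebra_simps)
    also have "\<dots> \<le> a * c + b * c'"
      using ab zc zc' by (intro add_mono mult_left_mono)
    finally have "(?z, a * c + b * c') \<in> K"
      unfolding K_def using enlargement_convex_combination[OF zc(2) zc'(2) ab] by blast
    then show "a *\<^sub>R k + b *\<^sub>R k' \<in> K"
      by (simp add: zc(1) zc'(1))
  qed
  have K_onto: "\<exists>c. (z, c) \<in> K" for z
    using surj G_K by blast
  have K_zero: "0 \<le> c" if c: "(0, c) \<in> K" for c
  proof -
    obtain t w where w: "w \<in> enlargement G t" "h t w 0 \<le> c"
      using c unfolding K_def by blast
    then show ?thesis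
      using gap[OF w(1)] by (simp add: h_def norm_Pair_power2[of "w - p"] add_divide_distrib)
  qed
  obtain l where l: "linear l" and l_le: "\<And>z c. (z, c) \<in> K \<Longrightarrow> l z \<le> c"
    using linear_below_convex_set[OF K_convex K_onto K_zero] by blast
  have l_h: "l z \<le> h 0 g z" if "g \<in> G" for z g
    using l_le G_K[OF that] by blast
  have "bounded_linear l"
  proof -
    obtain g where g: "g \<in> G"
      using surj by blast
    define M where "M = pairing (g - p) + (norm (fst (g - p)) + 1)\<^sup>2 / 2
      + (norm (snd (g - p)))\<^sup>2 / 2"
    have unit: "l z \<le> M" if "norm z = 1" for z
    proof -
      have "(norm (fst (g - p) - z))\<^sup>2 \<le> (norm (fst (g - p)) + 1)\<^sup>2"
        using norm_triangle_ineq4[of "fst (g - p)" z] that by (intro power_mono) auto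
      then show ?thesis
        using l_h[OF g, of z] d unfolding h_def M_def by linarith
    qed
    have bound: "l z \<le> norm z * M" for z
    proof (cases "z = 0")
      case True
      then show ?thesis using linear_0[OF l] by simp
    next
      case False
      then have "l ((1 / norm z) *\<^sub>R z) \<le> M"
        by (intro unit) simp
      then show ?thesis
        using False by (simp add: linear_scale[OF l] field_simps)
    qed
    show ?thesis
    proof (rule bounded_linear_intro)
      show "norm (l z) \<le> norm z * M" for z
        using bound[of z] bound[of "- z"] linear_neg[OF l, of z] by (simp add: abs_le_iff)
    qed (simp_all add: linear_add[OF l] linear_scale[OF l])
  qed
  then obtain y where y: "\<And>z. l z = blinfun_apply y z"
    using bounded_linear_Blinfun_apply by metis
  \<comment> \<open>This point has \<open>y\<close> as its second coordinate relative to \<open>p\<close>, which cancels \<open>y (s - fst p)\<close> below.\<close>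
  obtain s where s: "(s, y + snd p) \<in> G"
    using surj by blast
  obtain v where v: "blinfun_apply y v + (norm v)\<^sup>2 / 2 + (norm y)\<^sup>2 / 2 < d"
    using approximately_dual_vector[OF d] by blast
  have "blinfun_apply y (s - fst p - v) \<le> blinfun_apply y (s - fst p)
      + (norm v)\<^sup>2 / 2 + (norm y)\<^sup>2 / 2 - d"
    using l_h[OF s, of "s - fst p - v"] by (simp add: h_def y pairing_def)
  then show False
    using v by (simp add: blinfun.bilinear_simps)
qed

section \<open>From approximate to exact solutions\<close>

lemma enlargement_limit:
  assumes "\<And>n. w n \<in> enlargement G (e n)" "w \<longlonglongrightarrow> u" "e \<longlonglongrightarrow> t"
  shows "u \<in> enlargement G t"
  unfolding enlargement_def
proof (intro CollectI ballI)
  fix g assume g: "g \<in> G"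
  show "- t \<le> pairing (u - g)"
  proof (rule LIMSEQ_le)
    show "(\<lambda>n. - e n) \<longlonglongrightarrow> - t" "(\<lambda>n. pairing (w n - g)) \<longlonglongrightarrow> pairing (u - g)"
      by (intro tendsto_intros assms)+
    show "\<exists>N. \<forall>n\<ge>N. - e n \<le> pairing (w n - g)"
      using assms(1) g by (auto simp: enlargement_def)
  qed
qed

text \<open>
  Starting from \<open>w0\<close>, each new point is an approximate solution based at its predecessor. The parameters
  \<open>e n\<close> decrease by the factor \<open>4\<close>, hence the step lengths by the factor \<open>2\<close>: in a step,
  \<open>\<parallel>v - w\<parallel>\<^sup>2 / 2\<close> is at most \<open>e (Suc n) - pairing (v - w)\<close>, and the pairing is at least
  \<open>- 2 (e (Suc n) + e n)\<close>.
\<close>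

lemma surjective_graph_near_enlargement:
  fixes G :: "('a::banach \<times> 'a dual) set"
  assumes G: "maximally_monotone_subset G" and surj: "\<And>y. \<exists>x. (x, y) \<in> G"
    and r: "r > 0" and w0: "w0 \<in> enlargement G (r\<^sup>2)"
  obtains u where "u \<in> G" "norm (u - w0) \<le> 6 * r"
proof -
  define e where "e n = r\<^sup>2 * (1/4) ^ n" for n
  have e_pos: "e n > 0" for n
    using r by (simp add: e_def)
  have mono: "monotone_subset G"
    using G by (simp add: maximally_monotone_subset_def)
  have "\<exists>w. \<forall>n. (w n \<in> enlargement G (e n) \<and> (n = 0 \<longrightarrow> w n = w0)) \<and>
      norm (w (Suc n) - w n) \<le> 3 * r * (1/2) ^ n"
  proof (rule dependent_nat_choice)
    show "\<exists>w. w \<in> enlargement G (e 0) \<and> (0 = (0::nat) \<longrightarrow> w = w0)"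
      by (intro exI[of _ w0]) (simp add: e_def w0)
  next
    fix w n
    assume "w \<in> enlargement G (e n) \<and> (n = 0 \<longrightarrow> w = w0)"
    then have w: "w \<in> enlargement G (e n)" ..
    obtain t v where v: "v \<in> enlargement G t"
      and close: "t + (norm (v - w))\<^sup>2 / 2 + pairing (v - w) < e (Suc n)"
      using surjective_approximate_solution[OF mono surj e_pos] by blast
    have "t \<ge> 0"
      by (rule enlargement_maximal_nonneg[OF G v])
    have "t \<le> e (Suc n)"
      using close abs_pairing_le[of "v - w"] by (simp add: abs_le_iff)
    then have v': "v \<in> enlargement G (e (Suc n))"
      using v enlargement_mono by blast
    have "(norm (v - w))\<^sup>2 \<le> 2 * (e (Suc n) - pairing (v - w))"
      using close \<open>t \<ge> 0\<close> by simp
    also have "\<dots> \<le> 2 * (3 * e (Suc n) + 2 * e n)"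
      using enlargement_pairing_ge[OF G v' w] by simp
    also have "\<dots> \<le> 9 * e n"
      using e_pos[of n] by (simp add: e_def)
    also have "\<dots> = (3 * r * (1/2) ^ n)\<^sup>2"
    proof -
      have quarter: "(1/4 :: real) ^ n = ((1/2) ^ n)\<^sup>2"
        by (simp add: power2_eq_square flip: power_mult_distrib)
      show ?thesis
        unfolding e_def quarter by (simp add: power_mult_distrib)
    qed
    finally have "norm (v - w) \<le> 3 * r * (1/2) ^ n"
      by (rule power2_le_imp_le) (use r in simp)
    then show "\<exists>v. (v \<in> enlargement G (e (Suc n)) \<and> (Suc n = 0 \<longrightarrow> v = w0)) \<and>
        norm (v - w) \<le> 3 * r * (1/2) ^ n"
      using v' by blast
  qed
  then obtain w where w: "\<And>n. w n \<in> enlargement G (e n)" and w_0: "w 0 = w0"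
    and step: "\<And>n. norm (w (Suc n) - w n) \<le> 3 * r * (1/2) ^ n"
    by blast
  have geo: "(\<lambda>n. 3 * r * (1/2) ^ n) sums (3 * r * 2)"
    using sums_mult[OF geometric_sums[of "1/2::real"], of "3 * r"] by simp
  have summ: "summable (\<lambda>n. norm (w (Suc n) - w n))"
    by (rule summable_comparison_test[OF _ sums_summable[OF geo]]) (use step in auto)
  then have "(\<lambda>n. \<Sum>i<n. w (Suc i) - w i) \<longlonglongrightarrow> (\<Sum>i. w (Suc i) - w i)"
    by (rule summable_LIMSEQ[OF summable_norm_cancel])
  then have "(\<lambda>n. w n - w0) \<longlonglongrightarrow> (\<Sum>i. w (Suc i) - w i)"
    by (simp add: sum_lessThan_telescope w_0)
  from tendsto_add[OF this tendsto_const[of w0]]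
  have lim: "w \<longlonglongrightarrow> (\<Sum>i. w (Suc i) - w i) + w0" (is "_ \<longlonglongrightarrow> ?u")
    by simp
  have "e \<longlonglongrightarrow> 0"
    unfolding e_def by (intro tendsto_mult_right_zero LIMSEQ_power_zero) simp
  then have "?u \<in> enlargement G 0"
    using enlargement_limit[OF w lim] by blast
  then have "?u \<in> G"
    by (rule enlargement_zero_maximal[OF G])
  moreover have "norm (?u - w0) \<le> 6 * r"
  proof -
    have "norm (\<Sum>i. w (Suc i) - w i) \<le> (\<Sum>i. norm (w (Suc i) - w i))"
      by (rule summable_norm[OF summ])
    also have "\<dots> \<le> (\<Sum>i. 3 * r * (1/2) ^ i)"
      by (rule suminf_le[OF step summ sums_summable[OF geo]])
    also have "\<dots> = 6 * r"
      using sums_unique[OF geo] by simp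
    finally show ?thesis
      by simp
  qed
  ultimately show thesis
    by (rule that)
qed

text \<open>
  The distance from the approximate solution \<open>w\<close> to the graph is of order \<open>r\<close>, but the objective is quadratic,
  so passing to the nearby graph point \<open>u\<close> costs about \<open>\<parallel>w - p\<parallel> * r\<close>. It must therefore be known that
  \<open>w\<close> stays in a ball that does not depend on \<open>r\<close>. This follows by comparing with a fixed \<open>g \<in> G\<close>:
  \<open>pairing (w - g)\<close> is bounded below, hence \<open>pairing (w - p)\<close> is bounded below up to a term linear in
  \<open>\<parallel>w - p\<parallel>\<close>, which the quadratic term absorbs.
\<close>

lemma surjective_graph_quasidense:
  fixes G :: "('a::banach \<times> 'a dual) set"
  assumes G: "maximally_monotone_subset G" and surj: "\<And>y. \<exists>x. (x, y) \<in> G" and d: "d > 0"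
  obtains u where "u \<in> G" "(norm (u - p))\<^sup>2 / 2 + pairing (u - p) < d"
proof -
  have mono: "monotone_subset G"
    using G by (simp add: maximally_monotone_subset_def)
  obtain g where g: "g \<in> G"
    using surj by blast
  \<comment> \<open>This bounds \<open>a = \<parallel>w - p\<parallel>\<close> in \<open>a\<^sup>2 / 2 < 1 + b\<^sup>2 / 2 + 2 a b\<close>, where \<open>b = \<parallel>p - g\<parallel>\<close>.\<close>
  define M where "M = 5 * norm (p - g) + 2"
  have "M > 0"
    by (simp add: M_def add_nonneg_pos)
  \<comment> \<open>The final estimate is \<open>r\<^sup>2 + 3 M (6 r) + (6 r)\<^sup>2\<close>, at most \<open>r (18 M + 37)\<close> for \<open>r \<le> 1\<close>.\<close>
  define r where "r = min 1 (d / (18 * M + 37) / 2)"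
  have r: "0 < r" "r \<le> 1"
    using d \<open>M > 0\<close> by (auto simp: r_def)
  have "r \<le> d / (18 * M + 37) / 2"
    by (simp add: r_def)
  then have "r * (18 * M + 37) \<le> d / 2"
    using \<open>M > 0\<close> by (simp add: field_simps)
  then have r_d: "r * (18 * M + 37) < d"
    using d by simp
  have "r\<^sup>2 > 0"
    using r by simp
  then obtain t w where w: "w \<in> enlargement G t"
    and close: "t + (norm (w - p))\<^sup>2 / 2 + pairing (w - p) < r\<^sup>2"
    using surjective_approximate_solution[OF mono surj] by blast
  have "t \<ge> 0"
    by (rule enlargement_maximal_nonneg[OF G w])
  have "t \<le> r\<^sup>2"
    using close abs_pairing_le[of "w - p"] by (simp add: abs_le_iff)
  then have "w \<in> enlargement G (r\<^sup>2)"
    using w enlargement_mono by blast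
  then obtain u where u: "u \<in> G" "norm (u - w) \<le> 6 * r"
    using surjective_graph_near_enlargement[OF G surj r(1)] by blast
  have r2: "r\<^sup>2 \<le> r" "r\<^sup>2 \<le> 1"
    using r by (auto simp: power2_eq_square mult_le_one mult_left_le)
  have wp: "norm (w - p) \<le> M"
  proof -
    let ?a = "norm (w - p)" and ?b = "norm (p - g)"
    have "- t \<le> pairing ((w - p) + (p - g))"
      using w g by (simp add: enlargement_def)
    then have "- t \<le> pairing (w - p) + ?b\<^sup>2 / 2 + 2 * ?a * ?b"
      using pairing_add_le[of "w - p" "p - g"] by linarith
    then have "?a\<^sup>2 / 2 < 1 + ?b\<^sup>2 / 2 + 2 * ?a * ?b"
      using close r2 by simp
    then have "(?a - 2 * ?b)\<^sup>2 \<le> 2 + 5 * ?b\<^sup>2"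
      by (simp add: power2_eq_square algebra_simps)
    also have "\<dots> \<le> (3 * ?b + 2)\<^sup>2"
      by (simp add: power2_eq_square algebra_simps)
    finally have "?a - 2 * ?b \<le> 3 * ?b + 2"
      by (rule power2_le_imp_le) simp
    then show ?thesis
      by (simp add: M_def)
  qed
  have "(norm (u - p))\<^sup>2 / 2 + pairing (u - p) < d"
  proof -
    let ?a = "norm (w - p)" and ?b = "norm (u - w)"
    have up: "u - p = (w - p) + (u - w)"
      by simp
    have "(norm (u - p))\<^sup>2 \<le> (?a + ?b)\<^sup>2"
      unfolding up by (intro power_mono norm_triangle_ineq) simp
    moreover have "pairing (u - p) \<le> pairing (w - p) + ?b\<^sup>2 / 2 + 2 * ?a * ?b"
      unfolding up by (rule pairing_add_le)
    ultimately have "(norm (u - p))\<^sup>2 / 2 + pairing (u - p)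
        \<le> ?a\<^sup>2 / 2 + pairing (w - p) + 3 * ?a * ?b + ?b\<^sup>2"
      by (simp add: power2_eq_square algebra_simps)
    also have "\<dots> \<le> r\<^sup>2 + 3 * M * (6 * r) + (6 * r)\<^sup>2"
      using close \<open>t \<ge> 0\<close> wp u(2) \<open>M > 0\<close> by (intro add_mono mult_mono power_mono) auto
    also have "\<dots> \<le> r * (18 * M + 37)"
      using r2 by (simp add: power_mult_distrib algebra_simps)
    also have "\<dots> < d"
      by (rule r_d)
    finally show ?thesis .
  qed
  with u(1) show thesis
    by (rule that)
qed

theorem corollary6p8:
  fixes S :: "'a::banach \<Rightarrow> ('a \<Rightarrow>\<^sub>L real) set"
  assumes nonzero: "\<exists>x::'a. x \<noteq> 0"
    and maxmono: "maximally_monotone S"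
    and surjective: "(\<Union>x. S x) = UNIV"
  shows "quasidense S"
  unfolding quasidense_def
proof (intro allI)
  fix x :: 'a and xs :: "'a \<Rightarrow>\<^sub>L real"
  have G: "maximally_monotone_subset (mgraph S)"
    using maxmono by (simp add: maximally_monotone_def)
  have surj: "\<exists>x. (x, y) \<in> mgraph S" for y
    using surjective by (auto simp: mgraph_def)
  show "(INF (s, ss) \<in> mgraph S.
        ereal (1/2 * (norm (s - x))\<^sup>2 + 1/2 * (norm (ss - xs))\<^sup>2
               + blinfun_apply (ss - xs) (s - x))) \<le> 0"
  proof (rule ereal_le_epsilon2)
    fix d :: real assume "d > 0"
    then obtain u where u: "u \<in> mgraph S"
      "(norm (u - (x, xs)))\<^sup>2 / 2 + pairing (u - (x, xs)) < d"
      using surjective_graph_quasidense[OF G surj] by blast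
    then show "(INF (s, ss) \<in> mgraph S.
        ereal (1/2 * (norm (s - x))\<^sup>2 + 1/2 * (norm (ss - xs))\<^sup>2
               + blinfun_apply (ss - xs) (s - x))) \<le> 0 + ereal d"
      by (intro INF_lower2[OF u(1)])
        (auto simp: norm_Pair_power2[of "u - (x, xs)"] pairing_def add_divide_distrib split: prod.splits)
  qed
qed

end
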